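(* Let $I=(0,1)$, $\mu>0$, $\gamma>1$, $\rho_0\in C(\bar I)$ with $\rho_0>0$ in $I$, $\rho_0=0$ on $\partial I$, and $u_0,\mathfrak e_0$ continuous with $\mathfrak e_0\ge0$, $\mathfrak e_0\not\equiv0$. Suppose there exist positive $\lambda_5,\lambda_6,\lambda_7,\lambda_8$ with $0<\lambda_7,\lambda_8<1$ such that either ($\frac{(\rho_0)_x}{\rho_0}+\frac{(\mathfrak e_0)_x}{\rho_0}\ge\lambda_5$ in $(0,\lambda_7)$, $v_0(\lambda_7)<0$, $v_0\le0$ in $(0,\lambda_7)$) or ($\frac{(\rho_0)_x}{\rho_0}+\frac{(\mathfrak e_0)_x}{\rho_0}\le-\lambda_6$ in $(\lambda_8,1)$, $v_0(\lambda_8)>0$, $v_0\ge0$ in $(\lambda_8,1)$), where $v_0=u_0$. Then for every $T>0$ the problem $$\rho_0v_t+\Big(\frac{\rho_0\mathfrak e}{\eta_x}\Big)_x=\mu\Big(\frac{v_x}{\eta_x}\Big)_x,\qquad \rho_0\mathfrak e_t+(\gamma-1)\frac{\rho_0\mathfrak e v_x}{\eta_x}=\mu\frac{v_x^2}{\eta_x}\qquad\text{in } I\times(0,T],$$ $$\eta_t=v,\qquad (v,\mathfrak e,\eta)=(u_0,\mathfrak e_0,x)\text{ on } I\times\{t=0\},\qquad v=v_x=0\text{ on }\partial I\times(0,T],$$ has no solution $(v,\mathfrak e,\eta)$ in $C^{2,1}(\bar I\times[0,T])$.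
   Context: $C^{2,1}(\bar I\times[0,T])$ denotes functions that are $C^2$ in $x$ and $C^1$ in $t$ on $\bar I\times[0,T]$. *)

theory Defs
  imports "HOL-Analysis.Analysis"
begin

definition C21_derivs ::
  "(real \<Rightarrow> real \<Rightarrow> real) \<Rightarrow> (real \<Rightarrow> real \<Rightarrow> real) \<Rightarrow>
   (real \<Rightarrow> real \<Rightarrow> real) \<Rightarrow> (real \<Rightarrow> real \<Rightarrow> real) \<Rightarrow> real \<Rightarrow> bool" where
  "C21_derivs f fx fxx ft T \<longleftrightarrow>
     (\<forall>x\<in>{0..1}. \<forall>t\<in>{0..T}.
        ((\<lambda>y. f y t) has_real_derivative fx x t) (at x within {0..1}) \<and>
        ((\<lambda>y. fx y t) has_real_derivative fxx x t) (at x within {0..1}) \<and>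
        ((\<lambda>s. f x s) has_real_derivative ft x t) (at t within {0..T})) \<and>
     continuous_on ({0..1} \<times> {0..T}) (\<lambda>(x, t). f x t) \<and>
     continuous_on ({0..1} \<times> {0..T}) (\<lambda>(x, t). fx x t) \<and>
     continuous_on ({0..1} \<times> {0..T}) (\<lambda>(x, t). fxx x t) \<and>
     continuous_on ({0..1} \<times> {0..T}) (\<lambda>(x, t). ft x t)"

text \<open>Classical solution (v, e, eta) in C^{2,1} of the degenerate Lagrangian
  Navier--Stokes system with initial data (u0, e0, x) and boundary conditions
  v = v_x = 0 on the boundary of I.  The spatial derivatives of the fluxes
  rho0 e / eta_x and v_x / eta_x are required to exist classically in I.
  eta_x is required to be nonzero where the equations are imposed (so that the
  divisions make sense).\<close>

definition is_solution ::
  "(real \<Rightarrow> real) \<Rightarrow> (real \<Rightarrow> real) \<Rightarrow> (real \<Rightarrow> real) \<Rightarrow> real \<Rightarrow> real \<Rightarrow> real \<Rightarrow>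
   (real \<Rightarrow> real \<Rightarrow> real) \<Rightarrow> (real \<Rightarrow> real \<Rightarrow> real) \<Rightarrow> (real \<Rightarrow> real \<Rightarrow> real) \<Rightarrow> bool" where
  "is_solution rho0 u0 e0 mu gamma T v e eta \<longleftrightarrow>
     (\<exists>vx vxx vt ex exx et etax etaxx etat.
        C21_derivs v vx vxx vt T \<and> C21_derivs e ex exx et T \<and>
        C21_derivs eta etax etaxx etat T \<and>
        (\<forall>x\<in>{0<..<1}. \<forall>t\<in>{0<..T}.
           etax x t \<noteq> 0 \<and>
           (\<exists>P Q. ((\<lambda>y. rho0 y * e y t / etax y t) has_real_derivative P) (at x) \<and>
                  ((\<lambda>y. vx y t / etax y t) has_real_derivative Q) (at x) \<and>
                  rho0 x * vt x t + P = mu * Q) \<and>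
           rho0 x * et x t + (gamma - 1) * rho0 x * e x t * vx x t / etax x t
             = mu * (vx x t)\<^sup>2 / etax x t \<and>
           etat x t = v x t) \<and>
        (\<forall>x\<in>{0<..<1}. v x 0 = u0 x \<and> e x 0 = e0 x \<and> eta x 0 = x) \<and>
        (\<forall>x\<in>{0, 1}. \<forall>t\<in>{0<..T}. v x t = 0 \<and> vx x t = 0))"

end

theory Submission
  imports Defs
begin

text \<open>Suppose \<open>u0 \<le> 0\<close> on \<open>(0, X)\<close> and \<open>u0 X < 0\<close>; the other case follows by the reflection
  \<open>x \<mapsto> 1 - x\<close>, \<open>v \<mapsto> - v\<close>. The energy equation is a linear ODE in time, so \<open>e\<close> stays nonnegative.
  Since \<open>rho0\<close> and \<open>v\<^sub>x\<close> vanish at the left end point, integrating the momentum equation from there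
  shows that \<open>G = - \<integral>\<^sub>0\<^sup>x rho0 v\<close> satisfies
  \<open>G\<^sub>t = rho0 e / \<eta>\<^sub>x - \<mu> v\<^sub>x / \<eta>\<^sub>x \<ge> (\<mu> / \<eta>\<^sub>x) (G\<^sub>x / rho0)\<^sub>x\<close>: only the sign of the pressure enters, not that
  of its gradient. Comparison with an explicit barrier gives \<open>- v > 0\<close> at the left end point at a small
  positive time, contradicting the boundary condition \<open>v = 0\<close>.\<close>

section \<open>Preliminaries: a linear differential inequality in time and integrals with variable
  upper limit\<close>

text \<open>The weight \<open>exp (- K * s)\<close> turns the coefficient into \<open>K + a\<close>,
  which is positive. At a negative minimum of the weighted function its derivative would therefore
  be strictly positive, so a smaller value would occur just before; the initial condition excludes a
  minimum at time 0.\<close>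

lemma gronwall_nonneg:
  fixes f f' a :: "real \<Rightarrow> real"
  assumes deriv: "\<And>t. t \<in> {0..T} \<Longrightarrow> (f has_real_derivative f' t) (at t within {0..T})"
    and ineq: "\<And>t. t \<in> {0<..T} \<Longrightarrow> f' t + a t * f t \<ge> 0"
    and bound: "\<And>t. t \<in> {0<..T} \<Longrightarrow> \<bar>a t\<bar> < K"
    and init: "f 0 \<ge> 0"
    and t: "t \<in> {0..T}"
  shows "f t \<ge> 0"
proof (rule ccontr)
  assume neg: "\<not> f t \<ge> 0"
  define g where "g s = exp (- K * s) * f s" for s
  have dg: "(g has_real_derivative exp (- K * s) * (f' s - K * f s)) (at s within {0..T})"
    if "s \<in> {0..T}" for s
    unfolding g_def by (auto intro!: derivative_eq_intros deriv[OF that] simp: algebra_simps)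
  have "continuous_on {0..T} g"
    using dg by (rule DERIV_continuous_on)
  then obtain s where s: "s \<in> {0..T}" "\<And>r. r \<in> {0..T} \<Longrightarrow> g s \<le> g r"
    using continuous_attains_inf[of "{0..T}" g] t by auto
  have "g t < 0"
    using neg by (simp add: g_def mult_pos_neg)
  then have "g s < 0"
    using s(2)[OF t] by linarith
  then have fs: "f s < 0"
    by (simp add: g_def mult_less_0_iff)
  then have s0: "s \<in> {0<..T}"
    using s(1) init by (cases "s = 0") auto
  have "(K + a s) * f s < 0"
    using bound[OF s0] fs by (intro mult_pos_neg) auto
  then have "f' s - K * f s > 0"
    using ineq[OF s0] by (simp add: algebra_simps)
  then obtain d where d: "d > 0" "\<And>h. h > 0 \<Longrightarrow> s - h \<in> {0..T} \<Longrightarrow> h < d \<Longrightarrow> g (s - h) < g s"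
    using has_real_derivative_pos_inc_left[OF dg[OF s(1)]] by auto
  have "g (s - min s (d / 2)) < g s"
    using d(1) s0 by (intro d(2)) auto
  moreover have "g s \<le> g (s - min s (d / 2))"
    using d(1) s0 by (intro s(2)) auto
  ultimately show False by simp
qed

lemma continuous_on_slice:
  assumes "continuous_on (A \<times> B) (\<lambda>(x, t). f x t)"
  shows continuous_on_slice_fst: "t \<in> B \<Longrightarrow> continuous_on A (\<lambda>x. f x t)"
    and continuous_on_slice_snd: "x \<in> A \<Longrightarrow> continuous_on B (\<lambda>t. f x t)"
proof -
  show "continuous_on A (\<lambda>x. f x t)" if "t \<in> B"
    using that by (intro continuous_on_compose2[OF assms, of A "\<lambda>x. (x, t)", simplified])
      (auto intro!: continuous_intros)
  show "continuous_on B (\<lambda>t. f x t)" if "x \<in> A"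
    using that by (intro continuous_on_compose2[OF assms, of B "\<lambda>t. (x, t)", simplified])
      (auto intro!: continuous_intros)
qed

text \<open>The substitution \<open>y = x * s\<close> moves the variable upper limit into the
  integrand. What remains is a parameter integral over the fixed interval from 0 to 1, with a
  jointly continuous integrand.\<close>

lemma continuous_on_integral_upper_param:
  fixes f :: "real \<Rightarrow> real \<Rightarrow> real"
  assumes f: "continuous_on ({0..X} \<times> {0..T}) (\<lambda>(y, t). f y t)"
  shows "continuous_on ({0..X} \<times> {0..T}) (\<lambda>(x, t). integral {0..x} (\<lambda>y. f y t))"
proof -
  have eq: "integral {0..x} (\<lambda>y. f y t) = integral (cbox 0 1) (\<lambda>s. x * f (x * s) t)"
    if "x \<in> {0..X}" "t \<in> {0..T}" for x t
  proof -
    have "continuous_on {0..x} (\<lambda>y. f y t)"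
      by (rule continuous_on_subset[OF continuous_on_slice_fst[OF f that(2)]]) (use that in auto)
    then have "((\<lambda>s. x *\<^sub>R f (x * s) t) has_integral (integral {x * 0..x * 1} (\<lambda>y. f y t))) {0..1}"
      using that by (intro has_integral_substitution[where c = 0 and d = x])
        (auto intro!: derivative_eq_intros simp: mult_left_le)
    from integral_unique[OF this] show ?thesis
      by (simp add: cbox_interval)
  qed
  have "continuous_on (({0..X} \<times> {0..T}) \<times> cbox 0 1) (\<lambda>(p, s). fst p * f (fst p * s) (snd p))"
  proof -
    have "continuous_on (({0..X} \<times> {0..T}) \<times> cbox 0 1)
        (\<lambda>z. (\<lambda>(y, t). f y t) (fst (fst z) * snd z, snd (fst z)))"
      by (rule continuous_on_compose2[OF f])
        (auto intro!: continuous_intros simp: cbox_interval mult_left_le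
          intro: order_trans[OF mult_left_le])
    then show ?thesis
      by (auto intro!: continuous_intros simp: case_prod_beta)
  qed
  from integral_continuous_on_param[OF this] show ?thesis
    by (rule continuous_on_cong[THEN iffD1, rotated 2]) (auto simp: eq)
qed

section \<open>Comparison principle for the integrated degenerate diffusion equation\<close>

text \<open>The hypotheses on \<open>w\<close> make \<open>G x t = \<integral>\<^sub>0\<^sup>x rho w\<close> a supersolution of \<open>G\<^sub>t = c (G\<^sub>x / rho)\<^sub>x\<close>.
  It is compared with a small multiple of \<open>\<integral>\<^sub>0\<^sup>x rho b\<close>, where \<open>b = exp (M (y + k t - X)) - 1\<close>
  is nonpositive at time 0, while \<open>k = 2 X / T\<close> makes it positive at the corner \<open>(0, T)\<close>.
  Evaluating the order of the two integrals for small \<open>x\<close> gives the sign of \<open>w 0 T\<close>.\<close>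

lemma flux_boundary_positive:
  fixes rho :: "real \<Rightarrow> real" and w wx wt c :: "real \<Rightarrow> real \<Rightarrow> real"
  assumes X: "X > 0" and T: "T > 0" and c0: "c0 > 0"
    and rho: "continuous_on {0..X} rho" "\<And>x. x \<in> {0..X} \<Longrightarrow> rho x \<ge> 0"
      "\<And>x. x \<in> {0<..<X} \<Longrightarrow> rho x > 0"
    and w: "continuous_on ({0..X} \<times> {0..T}) (\<lambda>(x, t). w x t)"
    and wt: "continuous_on ({0..X} \<times> {0..T}) (\<lambda>(x, t). wt x t)"
    and dwt: "\<And>x t. x \<in> {0..X} \<Longrightarrow> t \<in> {0..T} \<Longrightarrow>
        ((\<lambda>s. w x s) has_real_derivative wt x t) (at t within {0..T})"
    and dwx: "\<And>x t. x \<in> {0<..<X} \<Longrightarrow> t \<in> {0<..T} \<Longrightarrow>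
        ((\<lambda>y. w y t) has_real_derivative wx x t) (at x)"
    and flux: "\<And>x t. x \<in> {0<..<X} \<Longrightarrow> t \<in> {0<..T} \<Longrightarrow>
        integral {0..x} (\<lambda>y. rho y * wt y t) \<ge> c x t * wx x t"
    and c: "\<And>x t. x \<in> {0<..<X} \<Longrightarrow> t \<in> {0<..T} \<Longrightarrow> c x t \<ge> c0"
    and init: "\<And>x. x \<in> {0..X} \<Longrightarrow> integral {0..x} (\<lambda>y. rho y * w y 0) \<ge> 0"
    and right: "\<And>t. t \<in> {0..T} \<Longrightarrow> integral {0..X} (\<lambda>y. rho y * w y t) > 0"
  shows "w 0 T > 0"
proof -
  obtain R where R: "R > 0" "\<And>x. x \<in> {0..X} \<Longrightarrow> rho x \<le> R"
  proof -
    have "bounded (rho ` {0..X})"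
      by (intro compact_imp_bounded compact_continuous_image rho) auto
    then obtain B where "\<forall>x\<in>{0..X}. \<bar>rho x\<bar> \<le> B"
      by (auto simp: bounded_real)
    then show ?thesis
      by (intro that[of "max 1 B"]) (auto intro: order_trans[OF abs_ge_self] simp: le_max_iff_disj)
  qed
  have rho_le: "rho x * a \<le> R * a" if "x \<in> {0..X}" "a \<ge> 0" for x a
    using R(2)[OF that(1)] that(2) by (rule mult_right_mono)
  define k where "k = 2 * X / T"
  \<comment> \<open>This \<open>M\<close> gives \<open>R * k < c0 * M\<close>, which makes the
    barrier a strict subsolution: the integral of \<open>rho\<close> times its time derivative, at
    most \<open>R * k * E\<close>, stays below its flux \<open>c * M * E\<close>.\<close>
  define M where "M = (R * k + 1) / c0"
  have k: "k > 0" using X T by (simp add: k_def)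
  have M: "M > 0" using R(1) k c0 by (simp add: M_def add_pos_pos)
  have M': "R * k < c0 * M" using c0 by (simp add: M_def)
  define E where "E x t = exp (M * (x + k * t - X))" for x t
  have E_pos: "E x t > 0" for x t by (simp add: E_def)
  have contE: "continuous_on S (\<lambda>(x, t). E x t)" for S
    unfolding E_def case_prod_beta by (intro continuous_intros)

  have contE1: "continuous_on S (\<lambda>(x, t). E x t - 1)" for S
    using contE[of S] unfolding case_prod_beta by (intro continuous_intros)

  have contF: "continuous_on ({0..X} \<times> {0..T}) (\<lambda>(x, t). integral {0..x} (\<lambda>y. rho y * f y t))"
    if "continuous_on ({0..X} \<times> {0..T}) (\<lambda>(x, t). f x t)" for f :: "real \<Rightarrow> real \<Rightarrow> real"
  proof (rule continuous_on_integral_upper_param)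
    have "continuous_on ({0..X} \<times> {0..T}) (\<lambda>z. rho (fst z))"
      by (rule continuous_on_compose2[OF rho(1)]) (auto intro!: continuous_intros)
    then show "continuous_on ({0..X} \<times> {0..T}) (\<lambda>(y, t). rho y * f y t)"
      using that by (auto simp: case_prod_beta intro!: continuous_intros)
  qed
  have slice_x: "continuous_on {0..x} (\<lambda>y. f y t)"
    if "continuous_on ({0..X} \<times> {0..T}) (\<lambda>(x, t). f x t)" "t \<in> {0..T}" "x \<le> X"
    for f :: "real \<Rightarrow> real \<Rightarrow> real" and x t
    by (rule continuous_on_subset[OF continuous_on_slice_fst[OF that(1,2)]]) (use that in auto)
  have rho_cont: "continuous_on {0..x} rho" if "x \<le> X" for x
    using rho(1) by (rule continuous_on_subset) (use that in auto)
  have integrable: "(\<lambda>y. rho y * f y t) integrable_on {0..x}"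
    if "continuous_on ({0..X} \<times> {0..T}) (\<lambda>(x, t). f x t)" "t \<in> {0..T}" "x \<le> X"
    for f :: "real \<Rightarrow> real \<Rightarrow> real" and x t
    by (intro integrable_continuous_real continuous_on_mult rho_cont slice_x that)

  obtain \<delta> where \<delta>: "\<delta> > 0" "\<And>t. t \<in> {0..T} \<Longrightarrow> integral {0..X} (\<lambda>y. rho y * w y t) \<ge> \<delta>"
  proof -
    have "continuous_on {0..T} (\<lambda>t. integral {0..X} (\<lambda>y. rho y * w y t))"
      using continuous_on_slice_snd[OF contF[OF w], of X] X by simp
    then obtain s where "s \<in> {0..T}" "\<And>t. t \<in> {0..T} \<Longrightarrow>
        integral {0..X} (\<lambda>y. rho y * w y s) \<le> integral {0..X} (\<lambda>y. rho y * w y t)"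
      using continuous_attains_inf[of "{0..T}" "\<lambda>t. integral {0..X} (\<lambda>y. rho y * w y t)"] T by auto
    then show ?thesis using right that by blast
  qed
  \<comment> \<open>The integral of \<open>rho * (E - 1)\<close> over \<open>{0..X}\<close> is at
    most \<open>R * E X T * X\<close>. With this factor the scaled barrier stays below \<delta>,
    hence below the integral of \<open>rho * w\<close>, on the side \<open>x = X\<close>.\<close>
  define \<epsilon> where "\<epsilon> = \<delta> / (R * E X T * X)"
  have \<epsilon>: "\<epsilon> > 0" using \<delta>(1) R(1) E_pos X by (simp add: \<epsilon>_def)

  \<comment> \<open>The difference between \<open>w\<close> and the scaled barrier, followed by its
    time derivative. The comparison concerns the weighted integral \<open>H\<close>, whose
    x-derivative is \<open>rho * h\<close>.\<close>
  define h where "h x t = w x t - \<epsilon> * (E x t - 1)" for x t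
  define ht where "ht x t = wt x t - \<epsilon> * (k * M * E x t)" for x t
  have conth: "continuous_on ({0..X} \<times> {0..T}) (\<lambda>(x, t). h x t)"
    using w contE[of "{0..X} \<times> {0..T}"] unfolding h_def case_prod_beta by (intro continuous_intros)
  have contht: "continuous_on ({0..X} \<times> {0..T}) (\<lambda>(x, t). ht x t)"
    using wt contE[of "{0..X} \<times> {0..T}"] unfolding ht_def case_prod_beta by (intro continuous_intros)
  define H where "H x t = integral {0..x} (\<lambda>y. rho y * h y t)" for x t
  have contH: "continuous_on ({0..X} \<times> {0..T}) (\<lambda>(x, t). H x t)"
    unfolding H_def by (rule contF[OF conth])
  have H_split: "H x t = integral {0..x} (\<lambda>y. rho y * w y t)
      - \<epsilon> * integral {0..x} (\<lambda>y. rho y * (E y t - 1))" if "x \<le> X" "t \<in> {0..T}" for x t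
  proof -
    have "continuous_on ({0..X} \<times> {0..T}) (\<lambda>(x, t). \<epsilon> * (E x t - 1))"
      using contE[of "{0..X} \<times> {0..T}"] unfolding case_prod_beta by (intro continuous_intros)
    from Henstock_Kurzweil_Integration.integral_diff[OF integrable[OF w that(2,1)] integrable[OF this that(2,1)]]
    show ?thesis
      by (simp add: H_def h_def algebra_simps flip: integral_mult_right)
  qed
  have dHx: "((\<lambda>y. H y t) has_real_derivative rho x * h x t) (at x)"
    if "x \<in> {0<..<X}" "t \<in> {0..T}" for x t
  proof -
    have "((\<lambda>y. H y t) has_real_derivative rho x * h x t) (at x within {0..X})"
      unfolding H_def using that
      by (intro integral_has_real_derivative continuous_on_mult rho slice_x[OF conth]) auto
    moreover have "at x within {0..X} = at x"
      using that by (intro at_within_interior) auto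
    ultimately show ?thesis by simp
  qed
  have dHt: "((\<lambda>s. H x s) has_real_derivative integral {0..x} (\<lambda>y. rho y * ht y t)) (at t within {0..T})"
    if "x \<in> {0..X}" "t \<in> {0..T}" for x t
  proof -
    have *: "continuous_on ({0..T} \<times> {0..x}) (\<lambda>z. (\<lambda>(x, t). ht x t) (snd z, fst z))"
      by (rule continuous_on_compose2[OF contht]) (use that in \<open>auto intro!: continuous_intros\<close>)
    have **: "continuous_on ({0..T} \<times> {0..x}) (\<lambda>z. rho (snd z))"
      by (rule continuous_on_compose2[OF rho(1)]) (use that in \<open>auto intro!: continuous_intros\<close>)
    have "((\<lambda>s. integral (cbox 0 x) (\<lambda>y. rho y * h y s)) has_field_derivative
        integral (cbox 0 x) (\<lambda>y. rho y * ht y t)) (at t within {0..T})"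
    proof (rule leibniz_rule_field_derivative)
      fix s y assume "s \<in> {0..T}" "y \<in> cbox 0 x"
      then show "((\<lambda>s. rho y * h y s) has_field_derivative rho y * ht y s) (at s within {0..T})"
        unfolding h_def ht_def E_def using that
        by (auto intro!: derivative_eq_intros dwt simp: cbox_interval)
    next
      show "continuous_on ({0..T} \<times> cbox 0 x) (\<lambda>(s, y). rho y * ht y s)"
        using * ** by (auto simp: cbox_interval case_prod_beta intro!: continuous_intros)
    qed (use that integrable[OF conth] in \<open>auto simp: cbox_interval\<close>)
    then show ?thesis by (simp add: H_def cbox_interval)
  qed

  \<comment> \<open>A negative minimum over the closed rectangle is impossible at
    \<open>x = 0\<close> (empty integral), at time 0 (the barrier is nonpositive there) and at
    \<open>x = X\<close> (choice of \<epsilon>). At any other point, minimality in x gives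
    \<open>h = 0\<close> and a nonnegative x-derivative of \<open>h\<close>. The flux inequality
    then makes the time derivative of \<open>H\<close> positive, so \<open>H\<close> is smaller
    slightly earlier. Looking backwards in time also covers the final time \<open>T\<close>.\<close>
  have H_nonneg: "H x t \<ge> 0" if xt: "x \<in> {0..X}" "t \<in> {0..T}" for x t
  proof (rule ccontr)
    assume "\<not> H x t \<ge> 0"
    obtain z where z: "z \<in> {0..X} \<times> {0..T}"
      "\<And>q. q \<in> {0..X} \<times> {0..T} \<Longrightarrow> (\<lambda>(x, t). H x t) z \<le> (\<lambda>(x, t). H x t) q"
      using continuous_attains_inf[OF _ _ contH] xt
      by (metis compact_Icc compact_Times empty_iff mem_Sigma_iff)
    obtain a s where as: "z = (a, s)" by (cases z)
    have a: "a \<in> {0..X}" and s: "s \<in> {0..T}"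
      and min: "\<And>x t. x \<in> {0..X} \<Longrightarrow> t \<in> {0..T} \<Longrightarrow> H a s \<le> H x t"
      using z by (auto simp: as)
    have neg: "H a s < 0"
      using min[OF xt] \<open>\<not> H x t \<ge> 0\<close> by linarith
    have "a \<noteq> 0" using neg by (auto simp: H_def)
    have "s \<noteq> 0"
    proof
      assume [simp]: "s = 0"
      have "integral {0..a} (\<lambda>y. rho y * (E y 0 - 1)) \<le> integral {0..a} (\<lambda>y. 0)"
      proof (rule integral_le)
        show "(\<lambda>y. rho y * (E y 0 - 1)) integrable_on {0..a}"
          using integrable[OF contE1, of 0 a] a T by auto
        fix y assume y: "y \<in> {0..a}"
        then have "E y 0 \<le> 1"
          using M a by (auto simp: E_def mult_nonneg_nonpos)
        then show "rho y * (E y 0 - 1) \<le> 0"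
          using rho(2)[of y] y a by (auto intro: mult_nonneg_nonpos)
      qed auto
      then have "\<epsilon> * integral {0..a} (\<lambda>y. rho y * (E y 0 - 1)) \<le> 0"
        using \<epsilon> by (simp add: mult_le_0_iff)
      then show False
        using neg H_split[of a 0] init[OF a] a T by auto
    qed
    have "a \<noteq> X"
    proof
      assume [simp]: "a = X"
      from integrable[OF contE1 s order_refl]
      have "integral {0..X} (\<lambda>y. rho y * (E y s - 1)) \<le> integral {0..X} (\<lambda>y. R * E X T)"
      proof (rule integral_le)
        fix y assume y: "y \<in> {0..X}"
        have "k * s \<le> k * T" using s k by (intro mult_left_mono) auto
        then have "E y s \<le> E X T"
          using y M by (auto simp: E_def)
        then have "rho y * (E y s - 1) \<le> rho y * E X T"
          using rho(2)[OF y] by (intro mult_left_mono) auto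
        also have "\<dots> \<le> R * E X T"
          using rho_le[OF y] E_pos[of X T] by auto
        finally show "rho y * (E y s - 1) \<le> R * E X T" .
      qed auto
      also have "\<dots> = R * E X T * X" using X by simp
      finally have "\<epsilon> * integral {0..X} (\<lambda>y. rho y * (E y s - 1)) \<le> \<epsilon> * (R * E X T * X)"
        using \<epsilon> by (intro mult_left_mono) auto
      also have "\<dots> = \<delta>"
        using R(1) E_pos[of X T] X by (simp add: \<epsilon>_def)
      finally show False
        using neg H_split[of X s] \<delta>(2)[OF s] s by auto
    qed
    have a': "a \<in> {0<..<X}" and s': "s \<in> {0<..T}"
      using a s \<open>a \<noteq> 0\<close> \<open>a \<noteq> X\<close> \<open>s \<noteq> 0\<close> by auto
    have "rho a * h a s = 0"
    proof (rule DERIV_local_min[OF dHx[OF a' s]])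
      show "0 < min a (X - a)" using a' by auto
      show "\<forall>y. \<bar>a - y\<bar> < min a (X - a) \<longrightarrow> H a s \<le> H y s"
        using a' s by (auto intro!: min simp: abs_if split: if_splits)
    qed
    then have ha: "h a s = 0" using rho(3)[OF a'] by auto
    define hx where "hx = wx a s - \<epsilon> * (M * E a s)"
    have dh: "((\<lambda>y. h y s) has_real_derivative hx) (at a)"
      unfolding h_def E_def hx_def by (auto intro!: derivative_eq_intros dwx[OF a' s'])
    \<comment> \<open>This replaces the second derivative test for \<open>H\<close>, whose
      x-derivative \<open>rho * h\<close> need not be differentiable as \<open>rho\<close> is only
      continuous. If \<open>hx\<close> were negative, \<open>h\<close> would be negative just to the
      right of \<open>a\<close>, and \<open>H\<close> would drop below its minimum.\<close>
    have "hx \<ge> 0"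
    proof (rule ccontr)
      assume "\<not> hx \<ge> 0"
      then obtain d where d: "d > 0" "\<And>r. r > 0 \<Longrightarrow> r < d \<Longrightarrow> h (a + r) s < h a s"
        using DERIV_neg_dec_right[OF dh] by auto
      define b where "b = a + min d (X - a) / 2"
      have b: "a < b" "b < a + d" "b < X"
        using d(1) a' by (auto simp: b_def min_def field_simps)
      have "H a s > H b s"
      proof (rule DERIV_neg_imp_decreasing_open[OF b(1)])
        fix y assume y: "a < y" "y < b"
        have "h y s < 0" using d(2)[of "y - a"] y b ha by auto
        then have "rho y * h y s < 0"
          using rho(3)[of y] y a' b by (intro mult_pos_neg) auto
        then show "\<exists>D. ((\<lambda>y. H y s) has_real_derivative D) (at y) \<and> D < 0"
          using dHx[of y s] y a' b s by auto
      next
        show "continuous_on {a..b} (\<lambda>y. H y s)"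
          using slice_x[OF contH s order_refl] by (rule continuous_on_subset) (use a' b in auto)
      qed
      then show False using min[of b s] a' b s by auto
    qed
    define P where "P = integral {0..a} (\<lambda>y. rho y * ht y s)"
    have "P > 0"
    proof -
      have c1: "continuous_on ({0..X} \<times> {0..T}) (\<lambda>(x, t). \<epsilon> * (k * M * E x t))"
        using contE[of "{0..X} \<times> {0..T}"] unfolding case_prod_beta by (intro continuous_intros)
      have "P = integral {0..a} (\<lambda>y. rho y * wt y s)
          - integral {0..a} (\<lambda>y. rho y * (\<epsilon> * (k * M * E y s)))"
        unfolding P_def ht_def using a
        by (simp add: right_diff_distrib Henstock_Kurzweil_Integration.integral_diff
            integrable[OF wt s] integrable[OF c1 s])
      moreover have "c a s * wx a s \<le> integral {0..a} (\<lambda>y. rho y * wt y s)"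
        by (rule flux[OF a' s'])
      \<comment> \<open>Once \<open>rho\<close> is bounded by \<open>R\<close>, the integrand has
        the explicit antiderivative \<open>\<epsilon> * R * k * E\<close>, because the x-derivative
        of \<open>E\<close> is \<open>M * E\<close>.\<close>
      moreover have "integral {0..a} (\<lambda>y. rho y * (\<epsilon> * (k * M * E y s)))
          \<le> \<epsilon> * R * k * (E a s - E 0 s)"
      proof -
        have ft: "((\<lambda>y. R * (\<epsilon> * (k * M * E y s))) has_integral
            \<epsilon> * R * k * E a s - \<epsilon> * R * k * E 0 s) {0..a}"
          unfolding E_def using a
          by (intro fundamental_theorem_of_calculus)
            (auto intro!: derivative_eq_intros simp flip: has_real_derivative_iff_has_vector_derivative)
        have "integral {0..a} (\<lambda>y. rho y * (\<epsilon> * (k * M * E y s)))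
            \<le> integral {0..a} (\<lambda>y. R * (\<epsilon> * (k * M * E y s)))"
          using a \<epsilon> k M E_pos ft
          by (intro integral_le integrable[OF c1 s] rho_le)
            (auto intro: less_imp_le)
        then show ?thesis unfolding integral_unique[OF ft] by (simp add: right_diff_distrib)
      qed
      moreover have "\<epsilon> * R * k * (E a s - E 0 s) \<le> \<epsilon> * R * k * E a s"
        using \<epsilon> R k E_pos[of 0 s] by (intro mult_left_mono) auto
      \<comment> \<open>The strict inequality comes from \<open>M'\<close>:
        \<open>hx \<ge> 0\<close> bounds \<open>wx\<close> below by
        \<open>\<epsilon> * M * E\<close>, and \<open>c\<close> is at least
        \<open>c0\<close>.\<close>
      moreover have "\<epsilon> * R * k * E a s < c a s * wx a s"
      proof -
        have wx_ge: "\<epsilon> * M * E a s \<le> wx a s" using \<open>hx \<ge> 0\<close> by (simp add: hx_def)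
        have "(R * k) * (\<epsilon> * E a s) < (c0 * M) * (\<epsilon> * E a s)"
          using M' \<epsilon> E_pos[of a s] by (intro mult_strict_right_mono) auto
        also have "\<dots> = c0 * (\<epsilon> * M * E a s)" by simp
        also have "\<dots> \<le> c a s * wx a s"
          using c[OF a' s'] wx_ge c0 \<epsilon> M E_pos[of a s] by (intro mult_mono) auto
        finally show ?thesis by (simp add: mult_ac)
      qed
      ultimately show ?thesis by linarith
    qed
    then obtain d where d: "d > 0" "\<And>r. r > 0 \<Longrightarrow> s - r \<in> {0..T} \<Longrightarrow> r < d \<Longrightarrow> H a (s - r) < H a s"
      using has_real_derivative_pos_inc_left[OF dHt[OF a s, folded P_def]] by auto
    have "H a (s - min s (d / 2)) < H a s"
      using d(1) s' by (intro d(2)) auto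
    moreover have "H a s \<le> H a (s - min s (d / 2))"
      using d(1) s' a by (intro min) auto
    ultimately show False by simp
  qed

  have T_in: "T \<in> {0..T}" using T by auto
  \<comment> \<open>\<open>H\<close> vanishes at \<open>x = 0\<close>. If \<open>h 0 T\<close> were
    negative, continuity would make \<open>H\<close> strictly decreasing near 0, contrary to
    \<open>H_nonneg\<close>.\<close>
  have "h 0 T \<ge> 0"
  proof (rule ccontr)
    assume neg: "\<not> h 0 T \<ge> 0"
    have cont: "continuous_on {0..X} (\<lambda>y. h y T)" by (rule slice_x[OF conth T_in order_refl])
    then obtain d where d: "d > 0" "\<And>y. y \<in> {0..X} \<Longrightarrow> dist y 0 < d \<Longrightarrow> dist (h y T) (h 0 T) < - h 0 T"
      using neg X unfolding continuous_on_iff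
      by (metis atLeastAtMost_iff less_eq_real_def neg_0_less_iff_less not_le)
    define b where "b = min d X / 2"
    have b: "0 < b" "b < d" "b < X" using d(1) X by (auto simp: b_def min_def)
    have "H 0 T > H b T"
    proof (rule DERIV_neg_imp_decreasing_open[OF b(1)])
      fix y assume y: "0 < y" "y < b"
      have "h y T < 0" using d(2)[of y] y b by (auto simp: dist_real_def)
      then have "rho y * h y T < 0"
        using rho(3)[of y] y b by (intro mult_pos_neg) auto
      then show "\<exists>D. ((\<lambda>y. H y T) has_real_derivative D) (at y) \<and> D < 0"
        using dHx[of y T] y b T_in by auto
    next
      show "continuous_on {0..b} (\<lambda>y. H y T)"
        using slice_x[OF contH T_in, of b] b by auto
    qed
    then show False using H_nonneg[of b T] b T_in by (auto simp: H_def)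
  qed
  moreover have "E 0 T > 1"
    using X T M by (simp add: E_def k_def)
  then have "\<epsilon> * (E 0 T - 1) > 0" using \<epsilon> by simp
  ultimately show ?thesis by (simp add: h_def)
qed

section \<open>Contradiction at the left end point\<close>

text \<open>The comparison is applied to \<open>w = - v\<close> and \<open>c = mu / etax\<close> on
  \<open>{0..X}\<close>, up to a time \<open>T'\<close> so small that \<open>etax\<close> stays
  close to 1 and the integral of \<open>- rho0 * v\<close> over \<open>{0..X}\<close> stays
  positive. Its conclusion \<open>- v 0 T' > 0\<close> violates the boundary condition.\<close>

lemma no_solution_if_inflow_at_left:
  fixes rho0 u0 e0 :: "real \<Rightarrow> real"
  assumes mu: "mu > 0" and rho: "continuous_on {0..1} rho0"
    and rho_pos: "\<And>x. x \<in> {0<..<1} \<Longrightarrow> rho0 x > 0" and rho_0: "rho0 0 = 0"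
    and e0: "\<And>x. x \<in> {0<..<1} \<Longrightarrow> e0 x \<ge> 0"
    and X: "X \<in> {0<..<1}" and u0_X: "u0 X < 0"
    and u0: "\<And>x. x \<in> {0<..<X} \<Longrightarrow> u0 x \<le> 0"
    and T: "T > 0"
  shows "\<not> is_solution rho0 u0 e0 mu gamma T v e eta"
proof
  assume "is_solution rho0 u0 e0 mu gamma T v e eta"
  then obtain vx vxx vt ex exx et etax etaxx etat where
    Cv: "C21_derivs v vx vxx vt T" and Ce: "C21_derivs e ex exx et T" and
    Ceta: "C21_derivs eta etax etaxx etat T" and
    mom: "\<And>x t. x \<in> {0<..<1} \<Longrightarrow> t \<in> {0<..T} \<Longrightarrow>
      \<exists>P Q. ((\<lambda>y. rho0 y * e y t / etax y t) has_real_derivative P) (at x) \<and>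
            ((\<lambda>y. vx y t / etax y t) has_real_derivative Q) (at x) \<and>
            rho0 x * vt x t + P = mu * Q" and
    energy: "\<And>x t. x \<in> {0<..<1} \<Longrightarrow> t \<in> {0<..T} \<Longrightarrow>
      rho0 x * et x t + (gamma - 1) * rho0 x * e x t * vx x t / etax x t = mu * (vx x t)\<^sup>2 / etax x t" and
    ini: "\<And>x. x \<in> {0<..<1} \<Longrightarrow> v x 0 = u0 x \<and> e x 0 = e0 x \<and> eta x 0 = x" and
    bd: "\<And>t. t \<in> {0<..T} \<Longrightarrow> v 0 t = 0 \<and> vx 0 t = 0"
    unfolding is_solution_def
    by (elim exE conjE) (rule that, assumption, assumption, assumption, blast+)
  have cv: "continuous_on ({0..1} \<times> {0..T}) (\<lambda>(x, t). v x t)"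
    and cvx: "continuous_on ({0..1} \<times> {0..T}) (\<lambda>(x, t). vx x t)"
    and cvt: "continuous_on ({0..1} \<times> {0..T}) (\<lambda>(x, t). vt x t)"
    and ce: "continuous_on ({0..1} \<times> {0..T}) (\<lambda>(x, t). e x t)"
    and cetax: "continuous_on ({0..1} \<times> {0..T}) (\<lambda>(x, t). etax x t)"
    using Cv Ce Ceta unfolding C21_derivs_def by blast+
  have dvt: "((\<lambda>s. v x s) has_real_derivative vt x t) (at t within {0..T})"
    and det: "((\<lambda>s. e x s) has_real_derivative et x t) (at t within {0..T})"
    if "x \<in> {0..1}" "t \<in> {0..T}" for x t
    using Cv Ce that unfolding C21_derivs_def by blast+
  have at_inner: "at x within {0..1} = at x" if "x \<in> {0<..<1}" for x :: real
    using that by (intro at_within_interior) auto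
  have dvx: "((\<lambda>y. v y t) has_real_derivative vx x t) (at x)"
    and detax: "((\<lambda>y. eta y t) has_real_derivative etax x t) (at x)"
    if "x \<in> {0<..<1}" "t \<in> {0..T}" for x t
    using Cv Ceta that unfolding C21_derivs_def by (fastforce simp flip: at_inner)+

  \<comment> \<open>The initial condition \<open>eta x 0 = x\<close> is prescribed in the open
    interval; continuity of \<open>etax\<close> carries the derivative 1 to the end points.\<close>
  have etax_0: "etax x 0 = 1" if "x \<in> {0..1}" for x
  proof (rule continuous_constant_on_closure[where f = "\<lambda>x. etax x 0" and S = "{0<..<1}"])
    show "continuous_on (closure {0<..<1}) (\<lambda>x. etax x 0)"
      using continuous_on_slice_fst[OF cetax, of 0] T by simp
    show "x \<in> closure {0<..<1}" using that by simp
  next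
    fix y :: real assume y: "y \<in> {0<..<1}"
    have "((\<lambda>x. eta x 0) has_real_derivative 1) (at y)"
      by (rule has_field_derivative_transform_within_open[OF DERIV_ident open_greaterThanLessThan y])
        (use ini in auto)
    with detax[OF y, of 0] T show "etax y 0 = 1" using DERIV_unique by auto
  qed
  \<comment> \<open>A solution is only known to have nonzero \<open>etax\<close> for interior points
    and positive times. Uniform continuity and \<open>etax_0\<close> yield a short time, uniform in
    x, with \<open>etax\<close> positive and below 2; the latter gives
    \<open>mu / etax \<ge> mu / 2\<close>.\<close>
  obtain d1 where d1: "d1 > 0" "\<And>x t. x \<in> {0..1} \<Longrightarrow> t \<in> {0..T} \<Longrightarrow> t < d1 \<Longrightarrow> \<bar>etax x t - 1\<bar> < 1 / 2"
  proof -
    have "uniformly_continuous_on ({0..1} \<times> {0..T}) (\<lambda>(x, t). etax x t)"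
      by (intro compact_uniformly_continuous cetax compact_Times) auto
    then obtain d where d: "d > 0" "\<And>p q. p \<in> {0..1} \<times> {0..T} \<Longrightarrow> q \<in> {0..1} \<times> {0..T} \<Longrightarrow>
        dist q p < d \<Longrightarrow> dist ((\<lambda>(x, t). etax x t) q) ((\<lambda>(x, t). etax x t) p) < 1 / 2"
      unfolding uniformly_continuous_on_def by (metis half_gt_zero_iff zero_less_one)
    show ?thesis
    proof (rule that[OF d(1)])
      fix x t :: real assume "x \<in> {0..1}" "t \<in> {0..T}" "t < d"
      with d(2)[of "(x, 0)" "(x, t)"] etax_0[of x] T show "\<bar>etax x t - 1\<bar> < 1 / 2"
        by (auto simp: dist_Pair_Pair dist_real_def)
    qed
  qed

  define G where "G x t = integral {0..x} (\<lambda>y. rho0 y * - v y t)" for x t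
  have cG: "continuous_on ({0..1} \<times> {0..T}) (\<lambda>(x, t). G x t)"
    unfolding G_def
  proof (rule continuous_on_integral_upper_param)
    have "continuous_on ({0..1} \<times> {0..T}) (\<lambda>z. rho0 (fst z))"
      by (rule continuous_on_compose2[OF rho]) (auto intro!: continuous_intros)
    then show "continuous_on ({0..1} \<times> {0..T}) (\<lambda>(y, t). rho0 y * - v y t)"
      using cv by (auto simp: case_prod_beta intro!: continuous_intros)
  qed
  have g_nonneg: "rho0 y * - v y 0 \<ge> 0" if "y \<in> {0..X}" for y
  proof (cases "y = 0")
    case False
    then have "y \<in> {0<..<1}" using that X by auto
    moreover have "u0 y \<le> 0" using False that u0 u0_X by (cases "y = X") auto
    ultimately show ?thesis using ini[of y] rho_pos[of y] by (auto simp: mult_le_0_iff)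
  qed (simp add: rho_0)
  have g_cont: "continuous_on {0..x} (\<lambda>y. rho0 y * - v y 0)" if "x \<le> X" for x
    using continuous_on_slice_fst[OF cv, of 0] T rho that X
    by (intro continuous_intros) (auto elim!: continuous_on_subset)
  have G_0: "G x 0 \<ge> 0" if "x \<in> {0..X}" for x
    unfolding G_def
    by (intro integral_nonneg integrable_continuous_real g_cont g_nonneg) (use that in auto)
  \<comment> \<open>A continuous nonnegative integrand with zero integral vanishes everywhere, but
    this one is positive at \<open>X\<close>.\<close>
  have "G X 0 \<noteq> 0"
  proof
    assume "G X 0 = 0"
    then have "((\<lambda>y. rho0 y * - v y 0) has_integral 0) (cbox 0 X)"
      using integrable_integral[OF integrable_continuous_real[OF g_cont[OF order_refl]]]
      by (simp add: G_def)
    then have "rho0 X * - v X 0 = 0"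
      by (rule has_integral_0_cbox_imp_0[rotated 2])
        (use X g_cont[OF order_refl] g_nonneg in \<open>auto simp: cbox_interval\<close>)
    then show False using rho_pos[OF X] ini[OF X] u0_X by auto
  qed
  then have G_X0: "G X 0 > 0" using G_0[of X] X by auto
  obtain d2 where d2: "d2 > 0" "\<And>t. t \<in> {0..T} \<Longrightarrow> t < d2 \<Longrightarrow> G X t > 0"
  proof -
    have "continuous_on {0..T} (\<lambda>t. G X t)" by (rule continuous_on_slice_snd[OF cG]) (use X in auto)
    then obtain d where d: "d > 0" "\<And>t. t \<in> {0..T} \<Longrightarrow> dist t 0 < d \<Longrightarrow> dist (G X t) (G X 0) < G X 0"
      using T G_X0 unfolding continuous_on_iff
      by (metis atLeastAtMost_iff less_eq_real_def order_refl)
    show ?thesis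
    proof (rule that[OF d(1)])
      fix t assume "t \<in> {0..T}" "t < d"
      with d(2)[of t] show "G X t > 0" by (auto simp: dist_real_def)
    qed
  qed

  define T' where "T' = min T (min d1 d2 / 2)"
  have T': "0 < T'" "T' \<le> T" "T' < d1" "T' < d2"
    using T d1(1) d2(1) by (auto simp: T'_def)
  have etax: "\<bar>etax x t - 1\<bar> < 1 / 2" if "x \<in> {0..1}" "t \<in> {0..T'}" for x t
    using d1(2)[of x t] that T' by auto
  have etax_pos: "etax x t > 0" if "x \<in> {0..1}" "t \<in> {0..T'}" for x t
    using etax[OF that] by (auto simp: abs_if split: if_splits)

  \<comment> \<open>For a fixed interior x, dividing the energy equation by \<open>rho0 x\<close>
    gives \<open>et + a * e \<ge> 0\<close> with \<open>a\<close> continuous in time. The bound on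
    \<open>a\<close> may depend on x, since the argument is pointwise in x.\<close>
  have e_nonneg: "e x t \<ge> 0" if x: "x \<in> {0<..<1}" and t: "t \<in> {0..T'}" for x t
  proof -
    define a where "a s = (gamma - 1) * vx x s / etax x s" for s
    have "continuous_on {0..T'} a"
      unfolding a_def
      by (intro continuous_intros continuous_on_subset[OF continuous_on_slice_snd[OF cvx]]
          continuous_on_subset[OF continuous_on_slice_snd[OF cetax]])
        (use x T' etax_pos[of x] in fastforce)+
    then have "bounded (a ` {0..T'})"
      by (intro compact_imp_bounded compact_continuous_image) auto
    then obtain B where B: "\<forall>s\<in>{0..T'}. \<bar>a s\<bar> \<le> B"
      by (auto simp: bounded_real)
    show ?thesis
    proof (rule gronwall_nonneg[OF _ _ _ _ t])
      show "((\<lambda>s. e x s) has_real_derivative et x s) (at s within {0..T'})" if "s \<in> {0..T'}" for s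
        by (rule DERIV_subset[OF det]) (use x that T' in auto)
      show "\<bar>a s\<bar> < B + 1" if "s \<in> {0<..T'}" for s
        using bspec[OF B, of s] that by auto
      show "e x 0 \<ge> 0" using ini[OF x] e0[OF x] by simp
      show "et x s + a s * e x s \<ge> 0" if s: "s \<in> {0<..T'}" for s
      proof -
        have "rho0 x * (et x s + a s * e x s) = mu * (vx x s)\<^sup>2 / etax x s"
          using energy[OF x, of s] s T' by (simp add: a_def algebra_simps)
        also have "\<dots> \<ge> 0"
          using mu etax_pos[of x s] x s by simp
        finally show ?thesis
          using rho_pos[OF x] by (simp add: zero_le_mult_iff)
      qed
    qed
  qed

  have sub: "{0..X} \<times> {0..T'} \<subseteq> {0..1} \<times> {0..T}" using X T' by auto
  have "- v 0 T' > 0"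
  proof (rule flux_boundary_positive[where rho = rho0 and w = "\<lambda>x t. - v x t"
        and wt = "\<lambda>x t. - vt x t" and wx = "\<lambda>x t. - vx x t"
        and c = "\<lambda>x t. mu / etax x t" and X = X and T = T' and ?c0.0 = "mu / 2"])
    show "X > 0" "T' > 0" "mu / 2 > 0" using X T' mu by auto
    show "continuous_on {0..X} rho0" by (rule continuous_on_subset[OF rho]) (use X in auto)
    show "rho0 x \<ge> 0" if "x \<in> {0..X}" for x
      using that X rho_0 rho_pos[of x] by (cases "x = 0") auto
    show "rho0 x > 0" if "x \<in> {0<..<X}" for x
      using that X by (intro rho_pos) auto
    show "continuous_on ({0..X} \<times> {0..T'}) (\<lambda>(x, t). - v x t)"
      using continuous_on_minus[OF continuous_on_subset[OF cv sub]] by (simp add: case_prod_beta)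
    show "continuous_on ({0..X} \<times> {0..T'}) (\<lambda>(x, t). - vt x t)"
      using continuous_on_minus[OF continuous_on_subset[OF cvt sub]] by (simp add: case_prod_beta)
    show "((\<lambda>s. - v x s) has_real_derivative - vt x t) (at t within {0..T'})"
      if "x \<in> {0..X}" "t \<in> {0..T'}" for x t
      by (rule DERIV_minus[OF DERIV_subset[OF dvt]]) (use that X T' in auto)
    show "((\<lambda>y. - v y t) has_real_derivative - vx x t) (at x)"
      if "x \<in> {0<..<X}" "t \<in> {0<..T'}" for x t
      by (rule DERIV_minus[OF dvx]) (use that X T' in auto)
    show "mu / etax x t \<ge> mu / 2" if "x \<in> {0<..<X}" "t \<in> {0<..T'}" for x t
      using etax[of x t] etax_pos[of x t] that X mu
      by (intro divide_left_mono) (auto simp: abs_if split: if_splits)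
    show "integral {0..x} (\<lambda>y. rho0 y * - v y 0) \<ge> 0" if "x \<in> {0..X}" for x
      using G_0[OF that] by (simp add: G_def)
    show "integral {0..X} (\<lambda>y. rho0 y * - v y t) > 0" if "t \<in> {0..T'}" for t
      using d2(2)[of t] that T' by (simp add: G_def)
  next
    fix x t assume x: "x \<in> {0<..<X}" and t: "t \<in> {0<..T'}"
    \<comment> \<open>\<open>S\<close> is the total flux, viscous stress minus pressure, with
      x-derivative \<open>rho0 * vt\<close> in the interior and continuous up to the left end point.
      There it vanishes because \<open>vx\<close> and \<open>rho0\<close> do. Dropping the
      nonnegative pressure from \<open>- S x\<close> leaves the required flux inequality.\<close>
    define S where "S y = mu * (vx y t / etax y t) - rho0 y * e y t / etax y t" for y
    have t': "t \<in> {0<..T}" using t T' by auto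
    have "((\<lambda>y. rho0 y * vt y t) has_integral S x - S 0) {0..x}"
    proof (rule fundamental_theorem_of_calculus_interior)
      show "0 \<le> x" using x by auto
      show "continuous_on {0..x} S"
        unfolding S_def
        by (intro continuous_intros continuous_on_subset[OF continuous_on_slice_fst[OF cvx]]
            continuous_on_subset[OF continuous_on_slice_fst[OF cetax]] continuous_on_subset[OF continuous_on_slice_fst[OF ce]]
            continuous_on_subset[OF rho])
          (use x X t' t etax_pos[of _ t] in fastforce)+
      fix y assume "y \<in> {0<..<x}"
      then have "y \<in> {0<..<1}" using x X by auto
      then obtain P Q where "((\<lambda>y. rho0 y * e y t / etax y t) has_real_derivative P) (at y)"
        "((\<lambda>y. vx y t / etax y t) has_real_derivative Q) (at y)"
        and PQ: "rho0 y * vt y t + P = mu * Q"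
        using mom t' by blast
      then have "(S has_real_derivative mu * Q - P) (at y)"
        unfolding S_def by (intro DERIV_diff DERIV_cmult)
      moreover have "mu * Q - P = rho0 y * vt y t" using PQ by simp
      ultimately show "(S has_vector_derivative rho0 y * vt y t) (at y)"
        by (simp add: has_real_derivative_iff_has_vector_derivative)
    qed
    moreover have "S 0 = 0" using bd[OF t'] rho_0 by (simp add: S_def)
    ultimately have "integral {0..x} (\<lambda>y. rho0 y * - vt y t) = - S x"
      by (simp add: integral_unique)
    moreover have "rho0 x * e x t / etax x t \<ge> 0"
      using rho_pos[of x] e_nonneg[of x t] etax_pos[of x t] x X t by simp
    ultimately show "integral {0..x} (\<lambda>y. rho0 y * - vt y t) \<ge> mu / etax x t * - vx x t"
      by (simp add: S_def)
  qed
  then show False using bd[of T'] T' by simp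
qed

section \<open>Reflection of the interval\<close>

text \<open>The offset \<open>c\<close> and factor \<open>s\<close> let one statement serve all
  three fields: 0 and -1 for \<open>v\<close>, 0 and 1 for \<open>e\<close>, 1 and -1 for
  \<open>eta\<close>. Each x-derivative contributes a factor -1.\<close>

lemma C21_derivs_reflect:
  assumes "C21_derivs f fx fxx ft T"
  shows "C21_derivs (\<lambda>x t. c + s * f (1 - x) t) (\<lambda>x t. - s * fx (1 - x) t)
    (\<lambda>x t. s * fxx (1 - x) t) (\<lambda>x t. s * ft (1 - x) t) T"
proof -
  have deriv: "((\<lambda>y. g (1 - y)) has_real_derivative - g') (at x within {0..1})"
    if "(g has_real_derivative g') (at (1 - x) within {0..1})" for g :: "real \<Rightarrow> real" and g' x
  proof -
    \<comment> \<open>The reflection maps \<open>{0..1}\<close> onto itself, so one-sided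
      derivatives at one end point correspond to one-sided derivatives at the other.\<close>
    have "(g has_real_derivative g') (at (1 - x) within (\<lambda>y. 1 - y) ` {0..1})"
      using that by simp
    moreover have "((\<lambda>y. 1 - y) has_real_derivative - 1) (at x within {0..1})"
      by (auto intro!: derivative_eq_intros)
    ultimately show ?thesis
      using DERIV_image_chain[of g g' "\<lambda>y. 1 - y" x "{0..1}" "- 1"] by (simp add: o_def)
  qed
  have cont: "continuous_on ({0..1} \<times> {0..T}) (\<lambda>(x, t). a + b * g (1 - x) t)"
    if "continuous_on ({0..1} \<times> {0..T}) (\<lambda>(x, t). g x t)" for g :: "real \<Rightarrow> real \<Rightarrow> real" and a b
  proof -
    have "continuous_on ({0..1} \<times> {0..T}) (\<lambda>z. (\<lambda>(x, t). g x t) (1 - fst z, snd z))"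
      by (rule continuous_on_compose2[OF that]) (auto intro!: continuous_intros)
    then show ?thesis by (auto simp: case_prod_beta intro!: continuous_intros)
  qed
  show ?thesis
    unfolding C21_derivs_def
  proof (intro conjI ballI)
    fix x t :: real assume xt: "x \<in> {0..1}" "t \<in> {0..T}"
    then have "1 - x \<in> {0..1}" by auto
    then have *: "((\<lambda>y. f y t) has_real_derivative fx (1 - x) t) (at (1 - x) within {0..1})"
      "((\<lambda>y. fx y t) has_real_derivative fxx (1 - x) t) (at (1 - x) within {0..1})"
      and ft: "((\<lambda>s. f (1 - x) s) has_real_derivative ft (1 - x) t) (at t within {0..T})"
      using assms xt unfolding C21_derivs_def by blast+
    show "((\<lambda>y. c + s * f (1 - y) t) has_real_derivative - s * fx (1 - x) t) (at x within {0..1})"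
      by (auto intro!: derivative_eq_intros deriv[OF *(1)])
    show "((\<lambda>y. - s * fx (1 - y) t) has_real_derivative s * fxx (1 - x) t) (at x within {0..1})"
      by (auto intro!: derivative_eq_intros deriv[OF *(2)])
    show "((\<lambda>r. c + s * f (1 - x) r) has_real_derivative s * ft (1 - x) t) (at t within {0..T})"
      by (auto intro!: derivative_eq_intros ft)
  qed (use assms[unfolded C21_derivs_def] cont[of f c s] cont[of fx 0 "- s"] cont[of fxx 0 s]
      cont[of ft 0 s] in simp_all)
qed

text \<open>Reversing x and the sign of \<open>v\<close> carries \<open>vx\<close> and
  \<open>etax\<close> over without change of sign. The energy equation is thus preserved, while
  every term of the momentum equation changes sign. Taking \<open>1 - eta\<close> keeps the initial
  value of the flow map equal to x.\<close>

lemma is_solution_reflect: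
  assumes "is_solution rho0 u0 e0 mu gamma T v e eta"
  shows "is_solution (\<lambda>x. rho0 (1 - x)) (\<lambda>x. - u0 (1 - x)) (\<lambda>x. e0 (1 - x)) mu gamma T
    (\<lambda>x t. - v (1 - x) t) (\<lambda>x t. e (1 - x) t) (\<lambda>x t. 1 - eta (1 - x) t)"
proof -
  obtain vx vxx vt ex exx et etax etaxx etat where
    C: "C21_derivs v vx vxx vt T" "C21_derivs e ex exx et T" "C21_derivs eta etax etaxx etat T" and
    pde: "\<And>x t. x \<in> {0<..<1} \<Longrightarrow> t \<in> {0<..T} \<Longrightarrow>
      etax x t \<noteq> 0 \<and>
      (\<exists>P Q. ((\<lambda>y. rho0 y * e y t / etax y t) has_real_derivative P) (at x) \<and>
            ((\<lambda>y. vx y t / etax y t) has_real_derivative Q) (at x) \<and>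
            rho0 x * vt x t + P = mu * Q) \<and>
      rho0 x * et x t + (gamma - 1) * rho0 x * e x t * vx x t / etax x t = mu * (vx x t)\<^sup>2 / etax x t \<and>
      etat x t = v x t" and
    ini: "\<And>x. x \<in> {0<..<1} \<Longrightarrow> v x 0 = u0 x \<and> e x 0 = e0 x \<and> eta x 0 = x" and
    bd: "\<And>x t. x \<in> {0, 1} \<Longrightarrow> t \<in> {0<..T} \<Longrightarrow> v x t = 0 \<and> vx x t = 0"
    using assms unfolding is_solution_def
    by (elim exE conjE) (rule that, assumption, assumption, assumption, blast+)
  have deriv: "((\<lambda>y. g (1 - y)) has_real_derivative - g') (at x)"
    if "(g has_real_derivative g') (at (1 - x))" for g :: "real \<Rightarrow> real" and g' x
  proof -
    have "((\<lambda>y. 1 - y) has_real_derivative - 1) (at x)"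
      by (auto intro!: derivative_eq_intros)
    from DERIV_chain2[where g = "\<lambda>y. 1 - y", OF that this] show ?thesis by simp
  qed
  have C': "C21_derivs (\<lambda>x t. - v (1 - x) t) (\<lambda>x t. vx (1 - x) t) (\<lambda>x t. - vxx (1 - x) t) (\<lambda>x t. - vt (1 - x) t) T"
    "C21_derivs (\<lambda>x t. e (1 - x) t) (\<lambda>x t. - ex (1 - x) t) (\<lambda>x t. exx (1 - x) t) (\<lambda>x t. et (1 - x) t) T"
    "C21_derivs (\<lambda>x t. 1 - eta (1 - x) t) (\<lambda>x t. etax (1 - x) t) (\<lambda>x t. - etaxx (1 - x) t) (\<lambda>x t. - etat (1 - x) t) T"
    using C21_derivs_reflect[OF C(1), of 0 "-1"] C21_derivs_reflect[OF C(2), of 0 1]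
      C21_derivs_reflect[OF C(3), of 1 "-1"] by simp_all
  show ?thesis
    unfolding is_solution_def
  proof (rule exI[of _ "\<lambda>x t. vx (1 - x) t"], rule exI[of _ "\<lambda>x t. - vxx (1 - x) t"],
      rule exI[of _ "\<lambda>x t. - vt (1 - x) t"], rule exI[of _ "\<lambda>x t. - ex (1 - x) t"],
      rule exI[of _ "\<lambda>x t. exx (1 - x) t"], rule exI[of _ "\<lambda>x t. et (1 - x) t"],
      rule exI[of _ "\<lambda>x t. etax (1 - x) t"], rule exI[of _ "\<lambda>x t. - etaxx (1 - x) t"],
      rule exI[of _ "\<lambda>x t. - etat (1 - x) t"], intro conjI ballI C')
    fix x t :: real assume "x \<in> {0<..<1}" and t: "t \<in> {0<..T}"
    then have x: "1 - x \<in> {0<..<1}" by auto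
    note pde = pde[OF x t]
    then obtain P Q where P: "((\<lambda>y. rho0 y * e y t / etax y t) has_real_derivative P) (at (1 - x))"
      and Q: "((\<lambda>y. vx y t / etax y t) has_real_derivative Q) (at (1 - x))"
      and PQ: "rho0 (1 - x) * vt (1 - x) t + P = mu * Q" by blast
    show "\<exists>P Q. ((\<lambda>y. rho0 (1 - y) * e (1 - y) t / etax (1 - y) t) has_real_derivative P) (at x) \<and>
            ((\<lambda>y. vx (1 - y) t / etax (1 - y) t) has_real_derivative Q) (at x) \<and>
            rho0 (1 - x) * - vt (1 - x) t + P = mu * Q"
      using deriv[OF P] deriv[OF Q] PQ by (intro exI[of _ "- P"] exI[of _ "- Q"]) auto
    show "etax (1 - x) t \<noteq> 0" "- etat (1 - x) t = - v (1 - x) t"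
      "rho0 (1 - x) * et (1 - x) t + (gamma - 1) * rho0 (1 - x) * e (1 - x) t * vx (1 - x) t / etax (1 - x) t
        = mu * (vx (1 - x) t)\<^sup>2 / etax (1 - x) t"
      using pde by auto
  qed (use ini bd in auto)
qed

section \<open>Nonexistence in both cases of the sign condition\<close>

theorem theorem3p2:
  fixes rho0 u0 e0 :: "real \<Rightarrow> real"
    and mu gamma lambda5 lambda6 lambda7 lambda8 T :: real
  assumes "mu > 0" and "gamma > 1"
    and "continuous_on {0..1} rho0"
    and "\<forall>x\<in>{0<..<1}. rho0 x > 0"
    and "rho0 0 = 0" and "rho0 1 = 0"
    and "continuous_on {0..1} u0"
    and "continuous_on {0..1} e0"
    and "\<forall>x\<in>{0..1}. e0 x \<ge> 0"
    and "\<exists>x\<in>{0..1}. e0 x \<noteq> 0"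
    and "lambda5 > 0" and "lambda6 > 0"
    and "0 < lambda7" and "lambda7 < 1" and "0 < lambda8" and "lambda8 < 1"
    and "(\<forall>x\<in>{0<..<lambda7}. \<exists>a b. (rho0 has_real_derivative a) (at x) \<and>
              (e0 has_real_derivative b) (at x) \<and> a / rho0 x + b / rho0 x \<ge> lambda5)
           \<and> u0 lambda7 < 0 \<and> (\<forall>x\<in>{0<..<lambda7}. u0 x \<le> 0)
         \<or> (\<forall>x\<in>{lambda8<..<1}. \<exists>a b. (rho0 has_real_derivative a) (at x) \<and>
              (e0 has_real_derivative b) (at x) \<and> a / rho0 x + b / rho0 x \<le> - lambda6)
           \<and> u0 lambda8 > 0 \<and> (\<forall>x\<in>{lambda8<..<1}. u0 x \<ge> 0)"
    and "T > 0"
  shows "\<not> (\<exists>v e eta. is_solution rho0 u0 e0 mu gamma T v e eta)"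
proof
  assume "\<exists>v e eta. is_solution rho0 u0 e0 mu gamma T v e eta"
  then obtain v e eta where sol: "is_solution rho0 u0 e0 mu gamma T v e eta" by blast
  consider "u0 lambda7 < 0" "\<forall>x\<in>{0<..<lambda7}. u0 x \<le> 0"
    | "u0 lambda8 > 0" "\<forall>x\<in>{lambda8<..<1}. u0 x \<ge> 0"
    using assms(17) by blast
  then show False
  proof cases
    case 1
    then show False
      using no_solution_if_inflow_at_left[of mu rho0 e0 lambda7 u0 T gamma v e eta] sol assms
      by auto
  next
    case 2
    \<comment> \<open>Reflection turns the interval from \<open>lambda8\<close> to 1 into the one
      from 0 to \<open>1 - lambda8\<close>, and the velocity \<open>- u0 (1 - x)\<close> satisfies
      the sign conditions at the left end.\<close>
    have "continuous_on {0..1} (\<lambda>x. rho0 (1 - x))"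
      by (rule continuous_on_compose2[OF assms(3)]) (auto intro!: continuous_intros)
    from no_solution_if_inflow_at_left[OF assms(1) this, where X = "1 - lambda8"
        and ?u0.0 = "\<lambda>x. - u0 (1 - x)" and ?e0.0 = "\<lambda>x. e0 (1 - x)"] is_solution_reflect[OF sol]
    show False using 2 assms by auto
  qed
qed

end
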